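(* Let $D$ be a (finite or infinite) digraph and let $\mathfrak{B}$ be a non-empty nested set of non-empty finite dicuts of $D$. Then the size of a smallest dicut in $\mathfrak{B}$ is equal to the size of a largest set of pairwise disjoint $\mathfrak{B}$-dijoins of $D$.
   Context: Digraphs may have parallel edges, but no loops. A bipartition of $V(D)$ is an ordered pair $(X,Y)$ with $X\cap Y=\emptyset$ and $X\cup Y=V(D)$; it is non-trivial if both $X$ and $Y$ are non-empty. $E_D(X,Y)$ is the set of edges with one endvertex in $X$ and the other in $Y$. A cut of $D$ is a set $B=E_D(X,Y)$ for some non-trivial bipartition $(X,Y)$ of $V(D)$. A dicut is a cut $B=E_D(X,Y)$ such that all edges of $B$ have their heads in the same one of the two sides $X,Y$; we then say that $(X,Y)$ represents the dicut $B$ (so representations of dicuts always have this property). Write $(X,Y)\le(X',Y')$ if $X\subseteq X'$ and $Y\supseteq Y'$. Two bipartitions $(X,Y)$, $(X',Y')$ are nested if one of $(X,Y),(Y,X)$ is $\le$-comparable with one of $(X',Y'),(Y',X')$. A set of bipartitions is nested if its elements are pairwise nested. A set $\mathfrak{B}$ of dicuts is nested if there is a nested set $\mathcal R$ of bipartitions of $V(D)$ such that every $B\in\mathfrak{B}$ is represented by some element of $\mathcal R$. A $\mathfrak{B}$-dijoin is a set of edges of $D$ meeting every dicut in $\mathfrak{B}$. *)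

theory Defs
  imports "Graph_Theory.Digraph"
begin

definition bipartition :: "('a, 'b) pre_digraph \<Rightarrow> 'a set \<times> 'a set \<Rightarrow> bool" where
  "bipartition D P \<longleftrightarrow> fst P \<inter> snd P = {} \<and> fst P \<union> snd P = verts D"

definition nontrivial_bipartition :: "('a, 'b) pre_digraph \<Rightarrow> 'a set \<times> 'a set \<Rightarrow> bool" where
  "nontrivial_bipartition D P \<longleftrightarrow> bipartition D P \<and> fst P \<noteq> {} \<and> snd P \<noteq> {}"

definition edges_between :: "('a, 'b) pre_digraph \<Rightarrow> 'a set \<Rightarrow> 'a set \<Rightarrow> 'b set" where
  "edges_between D X Y =
    {e \<in> arcs D. tail D e \<in> X \<and> head D e \<in> Y \<or> tail D e \<in> Y \<and> head D e \<in> X}"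

text \<open>The same edge set may arise as a cut from several bipartitions (if the digraph is not
  weakly connected), so the condition on the heads is imposed on the bipartition.\<close>

definition represents_dicut :: "('a, 'b) pre_digraph \<Rightarrow> 'a set \<times> 'a set \<Rightarrow> 'b set \<Rightarrow> bool" where
  "represents_dicut D P B \<longleftrightarrow>
    nontrivial_bipartition D P \<and> B = edges_between D (fst P) (snd P) \<and>
    (head D ` B \<subseteq> fst P \<or> head D ` B \<subseteq> snd P)"

definition dicut :: "('a, 'b) pre_digraph \<Rightarrow> 'b set \<Rightarrow> bool" where
  "dicut D B \<longleftrightarrow> (\<exists>P. represents_dicut D P B)"

definition bip_le :: "'a set \<times> 'a set \<Rightarrow> 'a set \<times> 'a set \<Rightarrow> bool" where
  "bip_le P Q \<longleftrightarrow> fst P \<subseteq> fst Q \<and> snd Q \<subseteq> snd P"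

definition nested_pair :: "'a set \<times> 'a set \<Rightarrow> 'a set \<times> 'a set \<Rightarrow> bool" where
  "nested_pair P Q \<longleftrightarrow>
    (\<exists>P' \<in> {P, prod.swap P}. \<exists>Q' \<in> {Q, prod.swap Q}. bip_le P' Q' \<or> bip_le Q' P')"

definition nested_bipartitions :: "('a set \<times> 'a set) set \<Rightarrow> bool" where
  "nested_bipartitions R \<longleftrightarrow> pairwise nested_pair R"

definition nested_dicuts :: "('a, 'b) pre_digraph \<Rightarrow> 'b set set \<Rightarrow> bool" where
  "nested_dicuts D \<BB> \<longleftrightarrow>
    (\<exists>R. (\<forall>P \<in> R. bipartition D P) \<and> nested_bipartitions R \<and>
         (\<forall>B \<in> \<BB>. \<exists>P \<in> R. represents_dicut D P B))"

definition dijoin_for :: "('a, 'b) pre_digraph \<Rightarrow> 'b set set \<Rightarrow> 'b set \<Rightarrow> bool" where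
  "dijoin_for D \<BB> J \<longleftrightarrow> J \<subseteq> arcs D \<and> (\<forall>B \<in> \<BB>. J \<inter> B \<noteq> {})"

definition disjoint_dijoins :: "('a, 'b) pre_digraph \<Rightarrow> 'b set set \<Rightarrow> 'b set set \<Rightarrow> bool" where
  "disjoint_dijoins D \<BB> \<J> \<longleftrightarrow> (\<forall>J \<in> \<J>. dijoin_for D \<BB> J) \<and> pairwise disjnt \<J>"

text \<open>Since \<open>card\<close> is 0 on infinite sets, finiteness of the competitors is part of the
  comparison of sizes.\<close>

definition largest_disjoint_dijoins ::
    "('a, 'b) pre_digraph \<Rightarrow> 'b set set \<Rightarrow> 'b set set \<Rightarrow> bool" where
  "largest_disjoint_dijoins D \<BB> \<J> \<longleftrightarrow>
    disjoint_dijoins D \<BB> \<J> \<and> finite \<J> \<and>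
    (\<forall>\<J>'. disjoint_dijoins D \<BB> \<J>' \<longrightarrow> finite \<J>' \<and> card \<J>' \<le> card \<J>)"

end

theory Submission
  imports Defs "HOL-Analysis.Function_Topology"
begin

text \<open>
  Let \<open>k\<close> be the least size of a dicut in \<open>\<BB>\<close>. Disjoint dijoins pick distinct elements of any fixed
  dicut, so there are at most \<open>k\<close> of them. Conversely, \<open>k\<close> disjoint dijoins are the classes of a
  colouring of the edges with \<open>k\<close> colours in which every dicut of \<open>\<BB>\<close> sees every colour. Such a
  colouring exists for the following reasons.

  Replacing each bipartition by its side that avoids one fixed vertex turns a nested family into a
  laminar family \<open>\<Z>\<close> of vertex sets. Any finite set of edges can be oriented anew so that across
  each \<open>Z \<in> \<Z>\<close> the numbers of entering and of leaving edges differ by at most one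
  (\<open>laminar_balanced_orientation\<close>). To see this, split every edge into two half-edges, placed at its
  two ends. As \<open>\<Z>\<close> is laminar, the half-edges can be paired so that each \<open>Z\<close> contains at most one
  half-edge without its partner in \<open>Z\<close> (\<open>laminar_involution\<close>). This pairing and the pairing of the
  two halves of each edge form a graph consisting of paths and even cycles, so the half-edges have
  signs that alternate along both pairings (\<open>alternating_signs\<close>), and the sign of a half-edge tells
  whether the new orientation enters or leaves there. Now colour an edge according to whether its
  new orientation agrees with the one in the digraph. All edges of a dicut cross it in the same
  direction, so the two colours occur equally often on it, up to one; in particular a dicut that
  contains at least two of the chosen edges sees both colours (\<open>laminar_cuts_bicolourable\<close>).

  For finitely many dicuts, take a \<open>k\<close>-colouring for which the total number of colours seen by the
  dicuts is maximal. If some dicut missed a colour \<open>i\<close>, it would see another colour \<open>j\<close> twice, and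
  bicolouring afresh the edges coloured \<open>i\<close> or \<open>j\<close> would increase that number (\<open>recolour\<close>).
  Since each dicut is finite, compactness of the space of \<open>k\<close>-colourings extends this to infinite
  \<open>\<BB>\<close> (\<open>bicolourable_full_colouring\<close>).
\<close>

section \<open>Pairing along a laminar family\<close>

definition laminar :: "'a set set \<Rightarrow> bool" where
  "laminar \<Z> \<longleftrightarrow> (\<forall>X\<in>\<Z>. \<forall>Y\<in>\<Z>. X \<subseteq> Y \<or> Y \<subseteq> X \<or> X \<inter> Y = {})"

text \<open>A pairing is encoded as an involution whose fixed points are the unpaired elements.\<close>

definition loose :: "('h \<Rightarrow> 'h) \<Rightarrow> 'h set \<Rightarrow> 'h set" where
  "loose \<beta> A = {h \<in> A. \<beta> h = h \<or> \<beta> h \<notin> A}"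

definition involution_on :: "'h set \<Rightarrow> ('h \<Rightarrow> 'h) \<Rightarrow> bool" where
  "involution_on A \<beta> \<longleftrightarrow> (\<forall>h\<in>A. \<beta> h \<in> A \<and> \<beta> (\<beta> h) = h)"

lemma ex_involution_one_fixpoint:
  assumes "finite U"
  shows "\<exists>\<gamma> u. involution_on U \<gamma> \<and> {h \<in> U. \<gamma> h = h} \<subseteq> {u}"
  using assms
proof (induction U)
  case empty
  then show ?case by (auto simp: involution_on_def)
next
  case (insert a U)
  then obtain \<gamma> u where \<gamma>: "involution_on U \<gamma>" "{h \<in> U. \<gamma> h = h} \<subseteq> {u}" by blast
  show ?case
  proof (cases "u \<in> U \<and> \<gamma> u = u")
    case True
    have "involution_on (insert a U) (\<gamma>(u := a, a := u))"
      using \<gamma>(1) insert.hyps True unfolding involution_on_def by (auto; metis)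
    moreover have "{h \<in> insert a U. (\<gamma>(u := a, a := u)) h = h} \<subseteq> {u}"
      using \<gamma>(2) insert.hyps True by auto
    ultimately show ?thesis by blast
  next
    case False
    have "involution_on (insert a U) (\<gamma>(a := a))"
      using \<gamma>(1) insert.hyps unfolding involution_on_def by auto
    moreover have "{h \<in> insert a U. (\<gamma>(a := a)) h = h} \<subseteq> {a}"
      using \<gamma>(2) False by auto
    ultimately show ?thesis by blast
  qed
qed

text \<open>The sets are added in order of size, so a new set \<open>X\<close> contains or misses each earlier set. Pairs
  crossing the boundary of \<open>X\<close> do not lie inside any earlier set and can be broken up; the elements
  then left over in \<open>X\<close> are paired with each other. No pair inside an earlier set is lost.\<close>

lemma laminar_involution:
  assumes "finite H" "finite \<L>" "laminar \<L>" "\<And>A. A \<in> \<L> \<Longrightarrow> A \<subseteq> H"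
  shows "\<exists>\<beta>. involution_on H \<beta> \<and> (\<forall>A\<in>\<L>. \<exists>u. loose \<beta> A \<subseteq> {u})"
  using assms(2-4)
proof (induction \<L> rule: finite_ranking_induct[where f = card])
  case empty
  have "involution_on H id" by (simp add: involution_on_def)
  then show ?case by blast
next
  case (insert X \<L>)
  have "laminar \<L>" "\<And>A. A \<in> \<L> \<Longrightarrow> A \<subseteq> H"
    using insert.prems by (auto simp: laminar_def)
  with insert.IH obtain \<beta> where \<beta>: "involution_on H \<beta>"
    and loose: "\<And>A. A \<in> \<L> \<Longrightarrow> \<exists>u. loose \<beta> A \<subseteq> {u}" by blast
  have XH: "X \<subseteq> H" using insert.prems by auto
  define U where "U = loose \<beta> X"
  have "finite U"
    using XH \<open>finite H\<close> unfolding U_def loose_def by (auto intro: finite_subset)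
  then obtain \<gamma> u where \<gamma>: "involution_on U \<gamma>" "{h \<in> U. \<gamma> h = h} \<subseteq> {u}"
    using ex_involution_one_fixpoint by blast
  define \<beta>' where
    "\<beta>' h = (if h \<in> X then if h \<in> U then \<gamma> h else \<beta> h else if \<beta> h \<in> X then h else \<beta> h)" for h
  have U: "h \<in> U \<longleftrightarrow> h \<in> X \<and> (\<beta> h = h \<or> \<beta> h \<notin> X)" for h
    by (auto simp: U_def loose_def)
  have inv\<beta>: "\<beta> h \<in> H" "\<beta> (\<beta> h) = h" if "h \<in> H" for h
    using \<beta> that by (auto simp: involution_on_def)
  have inv\<gamma>: "\<gamma> h \<in> U" "\<gamma> (\<gamma> h) = h" if "h \<in> U" for h
    using \<gamma> that by (auto simp: involution_on_def)
  have "\<beta>' h \<in> H \<and> \<beta>' (\<beta>' h) = h" if h: "h \<in> H" for h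
  proof -
    consider "h \<in> U" | "h \<in> X" "h \<notin> U" | "h \<notin> X" by blast
    then show ?thesis
    proof cases
      case 1
      then show ?thesis using inv\<gamma>[OF 1] XH U by (auto simp: \<beta>'_def)
    next
      case 2
      then have "\<beta> h \<in> X" "\<beta> h \<notin> U" using inv\<beta>[OF h] by (auto simp: U)
      then show ?thesis using 2 inv\<beta>[OF h] by (simp add: \<beta>'_def)
    next
      case 3
      then show ?thesis using inv\<beta>[OF h] h by (simp add: \<beta>'_def)
    qed
  qed
  then have "involution_on H \<beta>'" by (simp add: involution_on_def)
  moreover have "loose \<beta>' X \<subseteq> {u}"
    using \<gamma>(2) inv\<gamma>(1) by (auto simp: loose_def \<beta>'_def U split: if_splits)
  moreover have "loose \<beta>' A \<subseteq> loose \<beta> A" if A: "A \<in> \<L>" for A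
  proof -
    have "A \<subseteq> X \<or> A \<inter> X = {}"
    proof -
      have "X \<subseteq> A \<Longrightarrow> X = A"
        using insert.hyps A insert.prems(2)[of A] \<open>finite H\<close>
        by (metis card_seteq finite_subset insertI2)
      then show ?thesis using insert.prems(1) A unfolding laminar_def by blast
    qed
    then show ?thesis by (auto simp: loose_def \<beta>'_def U)
  qed
  ultimately show ?case
    by (metis insert_iff loose subset_trans)
qed

section \<open>Balanced orientations\<close>

text \<open>The pairs \<open>(e, False)\<close> and \<open>(e, True)\<close> are the two halves of the edge \<open>e\<close>. The halves of \<open>e\<close>
  and the pairs of \<open>\<beta>\<close> form two matchings, whose union has no odd cycle. The induction
  removes one edge \<open>e\<close>; if its two halves were paired with \<open>g\<close> and \<open>h\<close>, then \<open>g\<close> and \<open>h\<close> become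
  a pair, because the path from \<open>g\<close> to \<open>h\<close> through \<open>e\<close> has three steps and thus forces opposite
  signs on them.\<close>

lemma alternating_signs:
  fixes \<beta> :: "'e \<times> bool \<Rightarrow> 'e \<times> bool"
  assumes "finite S" "involution_on (S \<times> UNIV) \<beta>"
  shows "\<exists>c. (\<forall>e\<in>S. c (e, True) = (\<not> c (e, False))) \<and>
             (\<forall>h\<in>S \<times> UNIV. \<beta> h \<noteq> h \<longrightarrow> c (\<beta> h) = (\<not> c h))"
  using assms
proof (induction S arbitrary: \<beta>)
  case empty
  then show ?case by simp
next
  case (insert e S)
  define K where "K = {(e, False), (e, True)}"
  define \<alpha> where "\<alpha> h = (fst h, \<not> snd h)" for h :: "'e \<times> bool"
  \<comment> \<open>\<open>\<alpha>\<close> exchanges the halves of an edge, and \<open>\<beta>'\<close> bypasses the removed edge.\<close>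
  define \<beta>' where "\<beta>' h = (if \<beta> h \<notin> K then \<beta> h
      else if \<beta> (\<alpha> (\<beta> h)) \<notin> K then \<beta> (\<alpha> (\<beta> h)) else h)" for h
  have halves: "S \<times> UNIV \<union> K = insert e S \<times> UNIV" by (auto simp: K_def UNIV_bool)
  have \<beta>: "\<beta> h \<in> S \<times> UNIV \<union> K" "\<beta> (\<beta> h) = h" if "h \<in> S \<times> UNIV \<union> K" for h
    using insert.prems that unfolding involution_on_def halves by auto
  have \<alpha>: "\<alpha> h \<in> K \<longleftrightarrow> h \<in> K" "\<alpha> (\<alpha> h) = h" "\<alpha> h \<noteq> h" for h
    by (auto simp: \<alpha>_def K_def prod_eq_iff)
  have K2: "g = h \<or> g = \<alpha> h" if "g \<in> K" "h \<in> K" for g h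
    using that by (auto simp: \<alpha>_def K_def prod_eq_iff)
  have disj: "h \<notin> K" if "h \<in> S \<times> UNIV" for h
    using that insert.hyps by (auto simp: K_def)
  have "involution_on (S \<times> UNIV) \<beta>'"
    unfolding involution_on_def
  proof
    fix h assume h: "h \<in> S \<times> (UNIV :: bool set)"
    show "\<beta>' h \<in> S \<times> UNIV \<and> \<beta>' (\<beta>' h) = h"
      using \<beta>[of h] \<beta>[of "\<alpha> (\<beta> h)"] \<alpha> disj[OF h] h unfolding \<beta>'_def by auto
  qed
  from insert.IH[OF this] obtain c where
    c: "\<And>e. e \<in> S \<Longrightarrow> c (e, True) = (\<not> c (e, False))"
       "\<And>h. h \<in> S \<times> UNIV \<Longrightarrow> \<beta>' h \<noteq> h \<Longrightarrow> c (\<beta>' h) = (\<not> c h)" by blast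
  \<comment> \<open>The signs on the removed edge are dictated by one half \<open>k\<close>, chosen to be paired with another
    edge if either half is; if neither is, then \<open>c (\<beta> k)\<close> is an arbitrary value.\<close>
  obtain k where k: "k \<in> K" "\<beta> k \<in> K \<longrightarrow> \<beta> (\<alpha> k) \<in> K"
  proof (cases "\<beta> (e, False) \<in> K")
    case True
    then show ?thesis using that[of "(e, True)"] by (auto simp: \<alpha>_def K_def)
  next
    case False
    then show ?thesis using that[of "(e, False)"] by (auto simp: K_def)
  qed
  have KK: "K = {k, \<alpha> k}" using k K2 \<alpha> by blast
  define c' where "c' h = (if h = k then \<not> c (\<beta> k) else if h = \<alpha> k then c (\<beta> k) else c h)" for h
  have "c' (a, True) = (\<not> c' (a, False))" if "a \<in> insert e S" for a
  proof (cases "a = e")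
    case True
    then have "(k = (a, True) \<and> \<alpha> k = (a, False)) \<or> (k = (a, False) \<and> \<alpha> k = (a, True))"
      using k by (auto simp: K_def \<alpha>_def)
    then show ?thesis by (auto simp: c'_def)
  next
    case False
    then have "(a, b) \<noteq> k \<and> (a, b) \<noteq> \<alpha> k" for b using k by (auto simp: K_def \<alpha>_def)
    then show ?thesis using c(1)[of a] False that by (simp add: c'_def)
  qed
  moreover have "c' (\<beta> h) = (\<not> c' h)" if h: "h \<in> insert e S \<times> UNIV" "\<beta> h \<noteq> h" for h
  proof -
    have h': "h \<in> S \<times> UNIV \<union> K" using h by (auto simp: K_def)
    have kk: "k \<in> S \<times> UNIV \<union> K" "\<alpha> k \<in> S \<times> UNIV \<union> K" using k \<alpha> by auto
    have cross: "c' (\<beta> g) = (\<not> c' g)" if g: "g \<in> K" "\<beta> g \<notin> K" for g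
    proof (cases "g = k")
      case True
      then show ?thesis using g by (auto simp: c'_def KK)
    next
      case False
      then have gk: "g = \<alpha> k" using K2 g(1) k(1) by blast
      then have "\<beta> k \<notin> K" using g(2) k(2) by blast
      moreover have "\<beta> k \<noteq> \<beta> g" using \<beta>(2)[OF kk(1)] \<beta>(2)[OF kk(2)] gk False by metis
      ultimately have "\<beta>' (\<beta> k) = \<beta> g" "\<beta>' (\<beta> k) \<noteq> \<beta> k" "\<beta> k \<in> S \<times> UNIV"
        using \<beta>[OF kk(1)] g(2) gk k(1) by (auto simp: \<beta>'_def)
      then have "c (\<beta> g) = (\<not> c (\<beta> k))" using c(2) by metis
      then show ?thesis using g gk False by (auto simp: c'_def KK)
    qed
    consider (KK) "h \<in> K" "\<beta> h \<in> K" | (KS) "h \<in> K" "\<beta> h \<notin> K" | (SK) "h \<notin> K" "\<beta> h \<in> K"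
      | (SS) "h \<notin> K" "\<beta> h \<notin> K" by blast
    then show ?thesis
    proof cases
      case KK
      then show ?thesis using h(2) K2[OF KK] K2[OF KK(1) k(1)] K2[OF KK(2) k(1)] \<alpha>
        by (auto simp: c'_def)
    next
      case KS
      then show ?thesis by (rule cross)
    next
      case SK
      then show ?thesis using cross[of "\<beta> h"] \<beta>(2)[OF h'] by simp
    next
      case SS
      then have "h \<in> S \<times> UNIV" "\<beta>' h = \<beta> h" using h' by (auto simp: \<beta>'_def)
      then show ?thesis using c(2)[of h] h(2) SS by (auto simp: c'_def KK)
    qed
  qed
  ultimately show ?case by blast
qed

text \<open>The value \<open>\<sigma> e = 1\<close> means that \<open>e\<close> keeps its direction, so the sum is the number of edges
  entering \<open>Z\<close> minus the number leaving it. It equals the sum of the signs of all half-edges placed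
  in \<open>Z\<close>, where paired half-edges cancel and at most one is left.\<close>

lemma laminar_balanced_orientation:
  fixes t hd :: "'e \<Rightarrow> 'v"
  assumes "finite S" "laminar \<Z>"
  shows "\<exists>\<sigma> :: 'e \<Rightarrow> int. (\<forall>e. \<sigma> e = 1 \<or> \<sigma> e = -1) \<and>
    (\<forall>Z\<in>\<Z>. \<bar>\<Sum>e\<in>S. \<sigma> e * (of_bool (hd e \<in> Z) - of_bool (t e \<in> Z))\<bar> \<le> 1)"
proof -
  define H where "H = S \<times> (UNIV :: bool set)"
  define p where "p h = (if snd h then hd (fst h) else t (fst h))" for h
  define \<L> where "\<L> = (\<lambda>Z. {h \<in> H. p h \<in> Z}) ` \<Z>"
  have "finite H" using \<open>finite S\<close> by (simp add: H_def)
  moreover have "\<L> \<subseteq> Pow H" by (auto simp: \<L>_def)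
  moreover from this have "finite \<L>" using \<open>finite H\<close> by (simp add: finite_subset)
  moreover have "laminar \<L>"
    using \<open>laminar \<Z>\<close> unfolding laminar_def \<L>_def by (simp; blast)
  ultimately obtain \<beta> where \<beta>: "involution_on H \<beta>"
    and loose: "\<And>A. A \<in> \<L> \<Longrightarrow> \<exists>u. loose \<beta> A \<subseteq> {u}"
    using laminar_involution[of H \<L>] by blast
  obtain c where c: "\<And>e. e \<in> S \<Longrightarrow> c (e, True) = (\<not> c (e, False))"
      "\<And>h. h \<in> H \<Longrightarrow> \<beta> h \<noteq> h \<Longrightarrow> c (\<beta> h) = (\<not> c h)"
    using alternating_signs[OF \<open>finite S\<close> \<beta>[unfolded H_def]] unfolding H_def by metis
  define s where "s h = (if c h then 1 else - 1 :: int)" for h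
  have "\<bar>\<Sum>e\<in>S. s (e, True) * (of_bool (hd e \<in> Z) - of_bool (t e \<in> Z))\<bar> \<le> 1" if "Z \<in> \<Z>" for Z
  proof -
    define A where "A = {h \<in> H. p h \<in> Z}"
    have "A \<in> \<L>" using that by (auto simp: A_def \<L>_def)
    then obtain u where u: "loose \<beta> A \<subseteq> {u}" using loose by blast
    have fin: "finite A" using \<open>finite H\<close> by (simp add: A_def)
    have "sum s (A - loose \<beta> A) = (\<Sum>h\<in>A - loose \<beta> A. s (\<beta> h))"
      using \<beta> by (intro sum.reindex_bij_witness[of _ \<beta> \<beta>])
        (auto simp: involution_on_def loose_def A_def)
    also have "\<dots> = (\<Sum>h\<in>A - loose \<beta> A. - s h)"
      using c(2) by (intro sum.cong) (auto simp: loose_def s_def A_def)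
    finally have "sum s (A - loose \<beta> A) = 0" by (simp add: sum_negf)
    then have "sum s A = sum s (loose \<beta> A)"
      using sum.subset_diff[of "loose \<beta> A" A s] fin by (auto simp: loose_def)
    also have "\<bar>\<dots>\<bar> \<le> 1"
    proof -
      have "loose \<beta> A = {} \<or> loose \<beta> A = {u}" using u by blast
      then show ?thesis by (auto simp: s_def)
    qed
    finally have "\<bar>sum s A\<bar> \<le> 1" .
    moreover have "sum s A = (\<Sum>h\<in>H. s h * of_bool (p h \<in> Z))"
      using \<open>finite H\<close> by (auto simp: A_def sum.If_cases of_bool_def if_distrib Int_def cong: if_cong)
    moreover have "\<dots> = (\<Sum>e\<in>S. \<Sum>b\<in>UNIV. s (e, b) * of_bool (p (e, b) \<in> Z))"
      by (simp only: H_def sum.cartesian_product split_def prod.collapse)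
    moreover have "\<dots> = (\<Sum>e\<in>S. s (e, True) * (of_bool (hd e \<in> Z) - of_bool (t e \<in> Z)))"
      using c(1) by (intro sum.cong) (auto simp: UNIV_bool p_def s_def)
    ultimately show ?thesis by simp
  qed
  moreover have "s (e, True) = 1 \<or> s (e, True) = - 1" for e by (simp add: s_def)
  ultimately show ?thesis by (intro exI[of _ "\<lambda>e. s (e, True)"]) blast
qed

section \<open>Bicolouring nested dicuts\<close>

text \<open>The inclusion of the heads describes a dicut directed into \<open>Z\<close>, that of the tails one directed
  out of \<open>Z\<close>. Both are allowed because the side of a bipartition that avoids the fixed vertex can be
  either of the two.\<close>

definition one_way_cut :: "('a, 'b) pre_digraph \<Rightarrow> 'a set \<Rightarrow> 'b set \<Rightarrow> bool" where
  "one_way_cut D Z B \<longleftrightarrow> B = {e \<in> arcs D. (tail D e \<in> Z) \<noteq> (head D e \<in> Z)} \<and>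
     (head D ` B \<subseteq> Z \<or> tail D ` B \<subseteq> Z)"

text \<open>All that nestedness contributes to the passage to \<open>k\<close> colours. It is required of every finite
  \<open>S\<close> so that it can be applied to the union of two colour classes on finitely many dicuts.\<close>

definition bicolourable :: "'b set set \<Rightarrow> bool" where
  "bicolourable \<BB> \<longleftrightarrow> (\<forall>S. finite S \<longrightarrow>
     (\<exists>s :: 'b \<Rightarrow> bool. \<forall>B\<in>\<BB>. 2 \<le> card (B \<inter> S) \<longrightarrow> s ` (B \<inter> S) = UNIV))"

text \<open>Edges are coloured by whether a balanced orientation preserves or reverses them. If all edges of
  \<open>S\<close> in a one-way cut had the same colour, they would all still cross it in one direction, which a
  balanced orientation permits for at most one edge.\<close>

lemma laminar_cuts_bicolourable:
  assumes "laminar \<Z>" "\<And>B. B \<in> \<BB> \<Longrightarrow> \<exists>Z\<in>\<Z>. one_way_cut D Z B"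
  shows "bicolourable \<BB>"
  unfolding bicolourable_def
proof (intro allI impI)
  fix S :: "'b set" assume "finite S"
  define S' where "S' = S \<inter> arcs D"
  have fin: "finite S'" using \<open>finite S\<close> by (simp add: S'_def)
  obtain \<sigma> :: "'b \<Rightarrow> int" where \<sigma>: "\<And>e. \<sigma> e = 1 \<or> \<sigma> e = -1"
    and bal: "\<And>Z. Z \<in> \<Z> \<Longrightarrow>
      \<bar>\<Sum>e\<in>S'. \<sigma> e * (of_bool (head D e \<in> Z) - of_bool (tail D e \<in> Z))\<bar> \<le> 1"
    using laminar_balanced_orientation[OF fin \<open>laminar \<Z>\<close>, of "head D" "tail D"] by blast
  have "(\<lambda>e. \<sigma> e = 1) ` (B \<inter> S) = UNIV" if B: "B \<in> \<BB>" "2 \<le> card (B \<inter> S)" for B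
  proof (rule ccontr)
    assume "(\<lambda>e. \<sigma> e = 1) ` (B \<inter> S) \<noteq> UNIV"
    then have "(\<forall>e\<in>B \<inter> S. \<sigma> e = 1) \<or> (\<forall>e\<in>B \<inter> S. \<sigma> e = -1)"
      using \<sigma> by (auto simp: UNIV_bool image_iff)
    then obtain d where d: "\<And>e. e \<in> B \<inter> S \<Longrightarrow> \<sigma> e = d" "\<bar>d\<bar> = 1" by (metis abs_1 abs_minus)
    obtain Z where Z: "Z \<in> \<Z>" "one_way_cut D Z B" using assms(2) B(1) by blast
    define v where "v e = (of_bool (head D e \<in> Z) - of_bool (tail D e \<in> Z) :: int)" for e
    have BS: "B \<inter> S \<subseteq> S'" "\<And>e. e \<in> S' - B \<inter> S \<Longrightarrow> v e = 0"
      using Z(2) by (auto simp: one_way_cut_def S'_def v_def)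
    obtain g where g: "\<And>e. e \<in> B \<Longrightarrow> v e = g" "\<bar>g\<bar> = 1"
    proof (cases "head D ` B \<subseteq> Z")
      case True
      then have "v e = 1" if "e \<in> B" for e using that Z(2) by (auto simp: one_way_cut_def v_def)
      then show ?thesis using that[of 1] by simp
    next
      case False
      then have "tail D ` B \<subseteq> Z" using Z(2) by (auto simp: one_way_cut_def)
      then have "v e = -1" if "e \<in> B" for e using that Z(2) by (auto simp: one_way_cut_def v_def)
      then show ?thesis using that[of "-1"] by simp
    qed
    have "(\<Sum>e\<in>S'. \<sigma> e * v e) = (\<Sum>e\<in>B \<inter> S. \<sigma> e * v e)"
      using BS fin by (intro sum.mono_neutral_right) auto
    also have "\<dots> = (\<Sum>e\<in>B \<inter> S. d * g)"
      using d g by (intro sum.cong) auto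
    also have "\<bar>\<dots>\<bar> = int (card (B \<inter> S))"
      using d g by (simp add: abs_mult)
    finally show False using bal[OF Z(1)] B(2) by (simp add: v_def)
  qed
  then show "\<exists>s :: 'b \<Rightarrow> bool. \<forall>B\<in>\<BB>. 2 \<le> card (B \<inter> S) \<longrightarrow> s ` (B \<inter> S) = UNIV" by blast
qed

section \<open>From two colours to many\<close>

definition full_colouring :: "nat \<Rightarrow> 'b set set \<Rightarrow> ('b \<Rightarrow> nat) \<Rightarrow> bool" where
  "full_colouring k \<BB> f \<longleftrightarrow> (\<forall>e. f e < k) \<and> (\<forall>B\<in>\<BB>. {..<k} \<subseteq> f ` B)"

text \<open>The edge set \<open>C\<close> has at least \<open>k\<close> elements but misses a colour \<open>i\<close>, so some colour \<open>j\<close> occurs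
  on it twice. Bicolouring the edges of colour \<open>i\<close> or \<open>j\<close> gives \<open>C\<close> both colours. No other member of
  \<open>\<BB>\<close> loses: with at least two such edges it sees both colours afterwards, and with
  a single one it sees exactly one of them before and after.\<close>

lemma recolour:
  assumes "bicolourable \<BB>" "finite \<BB>" "\<And>B. B \<in> \<BB> \<Longrightarrow> finite B"
    and f: "\<And>e. f e < k" and C: "C \<in> \<BB>" "k \<le> card C" "\<not> {..<k} \<subseteq> f ` C"
  shows "\<exists>g :: 'b \<Rightarrow> nat. (\<forall>e. g e < k) \<and> (\<Sum>B\<in>\<BB>. card (f ` B)) < (\<Sum>B\<in>\<BB>. card (g ` B))"
proof -
  have finC: "finite C" using assms by blast
  obtain i where i: "i < k" "i \<notin> f ` C" using C(3) by blast
  have "f ` C \<subset> {..<k}" using f i by blast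
  then have "card (f ` C) < card C"
    using C(2) by (metis card_lessThan finite_lessThan order_less_le_trans psubset_card_mono)
  then obtain x y where xy: "x \<in> C" "y \<in> C" "x \<noteq> y" "f x = f y"
    using card_image inj_on_def by (metis less_irrefl)
  define j where "j = f x"
  have j: "j < k" "j \<noteq> i" using f i xy by (auto simp: j_def)
  define S where "S = {e \<in> \<Union>\<BB>. f e \<in> {i, j}}"
  have "finite S" using assms(2,3) by (simp add: S_def)
  then obtain s :: "'b \<Rightarrow> bool" where
    s: "\<And>B. B \<in> \<BB> \<Longrightarrow> 2 \<le> card (B \<inter> S) \<Longrightarrow> s ` (B \<inter> S) = UNIV"
    using \<open>bicolourable \<BB>\<close> unfolding bicolourable_def by metis
  define g where "g e = (if e \<in> S then if s e then i else j else f e)" for e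
  have split: "card (h ` B) = card (f ` (B - S)) + card (h ` (B \<inter> S))"
    if "B \<in> \<BB>" "h = f \<or> h = g" for h B
  proof -
    have "h ` B = f ` (B - S) \<union> h ` (B \<inter> S)"
      using that(2) by (auto simp: g_def)
    moreover have "f ` (B - S) \<inter> h ` (B \<inter> S) = {}"
      using that by (auto simp: g_def S_def split: if_splits)
    ultimately show ?thesis
      using assms(3)[OF that(1)] by (simp add: card_Un_disjoint)
  qed
  have two: "g ` (B \<inter> S) = {i, j}" if "B \<in> \<BB>" "2 \<le> card (B \<inter> S)" for B
  proof -
    have "g ` (B \<inter> S) = (\<lambda>b. if b then i else j) ` (s ` (B \<inter> S))"
      by (auto simp: g_def image_iff)
    then show ?thesis using s[OF that] by (auto simp: UNIV_bool)
  qed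
  have fS: "f ` (B \<inter> S) \<subseteq> {i, j}" for B by (auto simp: S_def)
  have le: "card (f ` B) \<le> card (g ` B)" if B: "B \<in> \<BB>" for B
  proof (cases "2 \<le> card (B \<inter> S)")
    case True
    have "card (f ` (B \<inter> S)) \<le> card {i, j}" by (rule card_mono[OF _ fS]) simp
    then show ?thesis using split[OF B] two[OF B True] by simp
  next
    case False
    have finB: "finite (B \<inter> S)" using assms(3)[OF B] by simp
    have "card (f ` (B \<inter> S)) \<le> card (B \<inter> S)" using finB by (rule card_image_le)
    also have "\<dots> = card (g ` (B \<inter> S))"
    proof -
      have "inj_on g (B \<inter> S)"
        using False card_le_Suc0_iff_eq[OF finB] by (auto intro: inj_onI)
      then show ?thesis by (simp add: card_image)
    qed
    finally show ?thesis using split[OF B] by simp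
  qed
  have "card (f ` C) < card (g ` C)"
  proof -
    have "{x, y} \<subseteq> C \<inter> S" using xy C(1) by (auto simp: S_def j_def)
    then have "2 \<le> card (C \<inter> S)"
      using card_mono[of "C \<inter> S" "{x, y}"] xy(3) finC by simp
    then have "card (g ` (C \<inter> S)) = 2" using two[OF C(1)] j by simp
    moreover have "f ` (C \<inter> S) \<subseteq> {j}" using fS[of C] i by auto
    then have "card (f ` (C \<inter> S)) \<le> 1" using card_mono[of "{j}"] by fastforce
    ultimately show ?thesis using split[OF C(1)] by simp
  qed
  then have "(\<Sum>B\<in>\<BB>. card (f ` B)) < (\<Sum>B\<in>\<BB>. card (g ` B))"
    using le C(1) \<open>finite \<BB>\<close> by (intro sum_strict_mono_ex1) auto
  moreover have "\<forall>e. g e < k" using f i j by (simp add: g_def)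
  ultimately show ?thesis by blast
qed

lemma bicolourable_full_colouring_finite:
  assumes "bicolourable \<BB>" "finite \<BB>" "\<And>B. B \<in> \<BB> \<Longrightarrow> finite B \<and> k \<le> card B" "0 < k"
  shows "\<exists>f. full_colouring k \<BB> f"
proof -
  define \<Phi> where "\<Phi> f = (\<Sum>B\<in>\<BB>. card (f ` B))" for f :: "'a \<Rightarrow> nat"
  have "\<Phi> f < Suc (\<Sum>B\<in>\<BB>. card B)" for f
    unfolding less_Suc_eq_le \<Phi>_def using assms(3) by (auto intro!: sum_mono card_image_le)
  moreover have "\<forall>e. (\<lambda>_ :: 'a. 0 :: nat) e < k" using \<open>0 < k\<close> by simp
  ultimately obtain f where f: "\<forall>e. f e < k" "\<And>g. \<forall>e. g e < k \<Longrightarrow> \<Phi> g \<le> \<Phi> f"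
    using ex_has_greatest_nat[of "\<lambda>f. \<forall>e. f e < k" "\<lambda>_. 0" \<Phi> "Suc (\<Sum>B\<in>\<BB>. card B)"]
    by auto
  have "{..<k} \<subseteq> f ` B" if B: "B \<in> \<BB>" for B
  proof (rule ccontr)
    assume "\<not> {..<k} \<subseteq> f ` B"
    then have "\<exists>g. (\<forall>e. g e < k) \<and> \<Phi> f < \<Phi> g"
      unfolding \<Phi>_def using assms(1-3) f(1) B by (intro recolour[of \<BB> f k B]) auto
    then show False using f(2) by (meson not_less)
  qed
  then show ?thesis using f(1) by (auto simp: full_colouring_def)
qed

section \<open>Compactness\<close>

text \<open>By Tychonoff's theorem the space of all \<open>k\<close>-colourings is compact. The colourings that are full
  on one finite set \<open>B\<close> form a closed set, since this depends on finitely many coordinates.\<close>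

lemma bicolourable_full_colouring:
  assumes "bicolourable \<BB>" "\<And>B. B \<in> \<BB> \<Longrightarrow> finite B \<and> k \<le> card B" "0 < k"
  shows "\<exists>f. full_colouring k \<BB> f"
proof -
  define K where "K = (PiE UNIV (\<lambda>_. {..<k}) :: ('a \<Rightarrow> nat) set)"
  define F where "F B = {f :: 'a \<Rightarrow> nat. {..<k} \<subseteq> f ` B}" for B
  have "compact K"
    unfolding K_def compactin_euclidean_iff[symmetric] euclidean_product_topology[symmetric]
    by (simp add: compactin_PiE finite_imp_compact)
  moreover have "closed (F B)" if "B \<in> \<BB>" for B
  proof -
    have "closed {f :: 'a \<Rightarrow> nat. f e = i}" for e i
      by (rule closed_Collect_eq[OF continuous_on_product_coordinates continuous_on_const])
    then have "closed (\<Inter>i<k. \<Union>e\<in>B. {f :: 'a \<Rightarrow> nat. f e = i})"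
      using assms(2)[OF that] by (intro closed_INT ballI closed_UN) auto
    also have "(\<Inter>i<k. \<Union>e\<in>B. {f :: 'a \<Rightarrow> nat. f e = i}) = F B"
      by (auto simp: F_def)
    finally show ?thesis .
  qed
  moreover have "K \<inter> \<Inter>(F ` \<BB>\<^sub>0) \<noteq> {}" if sub: "\<BB>\<^sub>0 \<subseteq> \<BB>" "finite \<BB>\<^sub>0" for \<BB>\<^sub>0
  proof -
    have "bicolourable \<BB>\<^sub>0"
      using \<open>bicolourable \<BB>\<close> sub(1) unfolding bicolourable_def by (meson subsetD)
    then obtain f where "full_colouring k \<BB>\<^sub>0 f"
      using bicolourable_full_colouring_finite[of \<BB>\<^sub>0 k] sub assms(2,3) by blast
    then have "f \<in> K \<inter> \<Inter>(F ` \<BB>\<^sub>0)" by (auto simp: full_colouring_def K_def F_def)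
    then show ?thesis by blast
  qed
  ultimately have "K \<inter> \<Inter>(F ` \<BB>) \<noteq> {}"
    by (rule compact_imp_fip_image)
  then obtain f where "f \<in> K" "\<forall>B\<in>\<BB>. f \<in> F B" by blast
  then show ?thesis unfolding full_colouring_def K_def F_def PiE_UNIV_domain by blast
qed

section \<open>Nested dicuts and disjoint dijoins\<close>

text \<open>Two sides chosen to avoid a common vertex \<open>r\<close> cannot cover all vertices. This excludes the one
  configuration of nested bipartitions in which the sides would be neither comparable nor
  disjoint.\<close>

lemma nested_dicuts_laminar:
  assumes "wf_digraph D" "nested_dicuts D \<BB>"
  shows "\<exists>\<Z>. laminar \<Z> \<and> (\<forall>B\<in>\<BB>. \<exists>Z\<in>\<Z>. one_way_cut D Z B)"
proof -
  obtain R where R: "\<And>P. P \<in> R \<Longrightarrow> bipartition D P" "nested_bipartitions R"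
    and rep: "\<And>B. B \<in> \<BB> \<Longrightarrow> \<exists>P\<in>R. represents_dicut D P B"
    using assms(2) unfolding nested_dicuts_def by blast
  define r where "r = (SOME r. r \<in> verts D)"
  define side where "side P = (if r \<in> fst P then snd P else fst P)" for P
  have side: "side P \<subseteq> verts D" "side P = fst P \<or> side P = snd P"
      "fst P \<inter> snd P = {}" "fst P \<union> snd P = verts D" if "P \<in> R" for P
    using R(1)[OF that] by (auto simp: side_def bipartition_def)
  have "side P \<subseteq> side Q \<or> side Q \<subseteq> side P \<or> side P \<inter> side Q = {}"
    if PQ: "P \<in> R" "Q \<in> R" for P Q
  proof (cases "P = Q \<or> verts D = {}")
    case True
    then show ?thesis using side(1)[OF PQ(1)] by auto
  next
    case False
    then have "r \<in> verts D" unfolding r_def by (simp add: some_in_eq)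
    have "nested_pair P Q"
      using False R(2) PQ by (auto simp: nested_bipartitions_def pairwise_def)
    then have "fst P \<subseteq> fst Q \<and> snd Q \<subseteq> snd P \<or> fst Q \<subseteq> fst P \<and> snd P \<subseteq> snd Q \<or>
        fst P \<subseteq> snd Q \<and> fst Q \<subseteq> snd P \<or> snd Q \<subseteq> fst P \<and> snd P \<subseteq> fst Q"
      by (auto simp: nested_pair_def bip_le_def)
    moreover have "snd P = verts D - fst P" "snd Q = verts D - fst Q"
      using side(3,4)[OF PQ(1)] side(3,4)[OF PQ(2)] by auto
    ultimately show ?thesis
      using \<open>r \<in> verts D\<close> by (cases "r \<in> fst P"; cases "r \<in> fst Q"; simp add: side_def; blast)
  qed
  then have "laminar (side ` R)" by (auto simp: laminar_def)
  moreover have "\<exists>Z\<in>side ` R. one_way_cut D Z B" if "B \<in> \<BB>" for B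
  proof -
    obtain P where P: "P \<in> R" "represents_dicut D P B" using rep \<open>B \<in> \<BB>\<close> by blast
    have ends: "tail D e \<in> fst P \<union> snd P" "head D e \<in> fst P \<union> snd P" if "e \<in> arcs D" for e
      using side(4)[OF P(1)] wf_digraph.tail_in_verts[OF assms(1) that]
        wf_digraph.head_in_verts[OF assms(1) that] by auto
    have "B = {e \<in> arcs D. (tail D e \<in> side P) \<noteq> (head D e \<in> side P)}"
      using P(2) side(2,3)[OF P(1)] ends
      unfolding represents_dicut_def edges_between_def by blast
    moreover have "head D ` B \<subseteq> side P \<or> tail D ` B \<subseteq> side P"
      using P(2) side(2,3)[OF P(1)]
      unfolding represents_dicut_def edges_between_def by blast
    ultimately have "one_way_cut D (side P) B" by (simp add: one_way_cut_def)
    then show ?thesis using P(1) by blast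
  qed
  ultimately show ?thesis by blast
qed

lemma disjoint_dijoins_card_le:
  assumes "disjoint_dijoins D \<BB> \<J>" "B \<in> \<BB>" "finite B"
  shows "finite \<J> \<and> card \<J> \<le> card B"
proof -
  have "\<exists>e. e \<in> J \<inter> B" if "J \<in> \<J>" for J
    using assms that unfolding disjoint_dijoins_def dijoin_for_def by blast
  then obtain e where e: "\<And>J. J \<in> \<J> \<Longrightarrow> e J \<in> J \<inter> B" by metis
  have "inj_on e \<J>"
    using e assms(1) unfolding inj_on_def disjoint_dijoins_def pairwise_def disjnt_def
    by (metis IntD1 IntI empty_iff)
  moreover have "e ` \<J> \<subseteq> B" using e by blast
  ultimately show ?thesis using \<open>finite B\<close> by (meson card_inj_on_le inj_on_finite)
qed

lemma full_colouring_disjoint_dijoins: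
  assumes "full_colouring k \<BB> f" "\<BB> \<noteq> {}" "\<And>B. B \<in> \<BB> \<Longrightarrow> B \<subseteq> arcs D"
  shows "\<exists>\<J>. disjoint_dijoins D \<BB> \<J> \<and> finite \<J> \<and> card \<J> = k"
proof -
  define J where "J i = {e \<in> arcs D. f e = i}" for i
  have hit: "J i \<inter> B \<noteq> {}" if "i < k" "B \<in> \<BB>" for i B
    using assms(1,3) that unfolding full_colouring_def J_def by blast
  have "inj_on J {..<k}"
  proof (rule inj_onI)
    fix i j assume "i \<in> {..<k}" "J i = J j"
    moreover obtain B where "B \<in> \<BB>" using assms(2) by blast
    ultimately obtain e where "e \<in> J i" "e \<in> J j" using hit[of i B] by blast
    then show "i = j" by (simp add: J_def)
  qed
  then have "card (J ` {..<k}) = k" by (simp add: card_image)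
  moreover have "disjoint_dijoins D \<BB> (J ` {..<k})"
    using hit unfolding disjoint_dijoins_def dijoin_for_def pairwise_def disjnt_def
    by (auto simp: J_def)
  ultimately show ?thesis by blast
qed

theorem theorem3:
  fixes D :: "('a, 'b) pre_digraph" and \<BB> :: "'b set set"
  assumes "loopfree_digraph D"
    and "\<BB> \<noteq> {}"
    and "\<And>B. B \<in> \<BB> \<Longrightarrow> dicut D B \<and> finite B \<and> B \<noteq> {}"
    and "nested_dicuts D \<BB>"
  shows "\<exists>B \<J>. is_arg_min card (\<lambda>B. B \<in> \<BB>) B \<and>
               largest_disjoint_dijoins D \<BB> \<J> \<and> card B = card \<J>"
proof -
  obtain B where B: "B \<in> \<BB>" "\<And>C. C \<in> \<BB> \<Longrightarrow> card B \<le> card C"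
    using assms(2) ex_has_least_nat[of "\<lambda>B. B \<in> \<BB>" _ card] by blast
  have min: "is_arg_min card (\<lambda>B. B \<in> \<BB>) B"
    using B by (auto simp: is_arg_min_def not_less)
  have "wf_digraph D" using assms(1) by (simp add: loopfree_digraph_def)
  then have "bicolourable \<BB>"
    using nested_dicuts_laminar[OF _ assms(4)] laminar_cuts_bicolourable by metis
  moreover have "0 < card B" using assms(3) B(1) by (simp add: card_gt_0_iff)
  ultimately obtain f where "full_colouring (card B) \<BB> f"
    using bicolourable_full_colouring[of \<BB> "card B"] assms(3) B(2) by blast
  moreover have "C \<subseteq> arcs D" if "C \<in> \<BB>" for C
    using assms(3)[OF that] by (auto simp: dicut_def represents_dicut_def edges_between_def)
  ultimately obtain \<J> where \<J>: "disjoint_dijoins D \<BB> \<J>" "finite \<J>" "card \<J> = card B"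
    using full_colouring_disjoint_dijoins[of "card B" \<BB> f D] assms(2) by blast
  have "largest_disjoint_dijoins D \<BB> \<J>"
    using \<J> disjoint_dijoins_card_le[of D \<BB> _ B] B(1) assms(3)
    unfolding largest_disjoint_dijoins_def by metis
  with min \<J>(3) show ?thesis by metis
qed

end
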